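(* Let $A_2\in\mathbf{C}^{n\times n}$, $B_2\in\mathbf{C}^{n\times m}$ be such that the antilinear system $x^+=A_2^{\#}x^{\#}+B_2^{\#}u^{\#}$ is controllable, and let $F_2\in\mathbf{C}^{p\times p}$. Let $N_0(s)$ and $D_0(s)$ be polynomial matrices of sizes $n\times m$ and $m\times m$ satisfying $$sN_0^{\#}(s)-A_2N_0(s)=B_2D_0(s)$$ and $$\mathrm{rank}\begin{bmatrix} N_0(s) & -N_0(-s) \\ D_0(s) & -D_0(-s) \\ N_0^{\#}(s) & N_0^{\#}(-s) \\ D_0^{\#}(s) & D_0^{\#}(-s) \end{bmatrix}=2m,\quad\forall s\in\mathbf{C},$$ and write $\begin{bmatrix} N_0(s) \\ D_0(s) \end{bmatrix}=\sum_{i=0}^{\omega}\begin{bmatrix} N_{0,i} \\ D_{0,i} \end{bmatrix}s^i$. Then complete solutions $(X_1,Y_1)\in\mathbf{C}^{n\times p}\times\mathbf{C}^{m\times p}$ to $$A_2^{\#}X_1^{\#}+B_2^{\#}Y_1^{\#}=X_1F_2^{\#}$$ are given by $$\begin{bmatrix} X_1 \\ Y_1 \end{bmatrix}=\sum_{\substack{0\le i\le\omega \\ i\text{ even}}}\begin{bmatrix} N_{0,i} \\ D_{0,i} \end{bmatrix}Z_1(F_2^{\#}F_2)^{\frac i2}+\sum_{\substack{0\le i\le\omega \\ i\text{ odd}}}\begin{bmatrix} N_{0,i} \\ D_{0,i} \end{bmatrix}Z_1^{\#}F_2(F_2^{\#}F_2)^{\frac{i-1}2},$$ and complete solutions $(X_2,Y_2)\in\mathbf{C}^{n\times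 p}\times\mathbf{C}^{m\times p}$ to $$A_2^{\#}X_2+B_2^{\#}Y_2=X_2^{\#}F_2$$ are given by $$\begin{bmatrix} X_2 \\ Y_2 \end{bmatrix}=\sum_{\substack{0\le i\le\omega \\ i\text{ even}}}\begin{bmatrix} N_{0,i}^{\#} \\ D_{0,i}^{\#} \end{bmatrix}Z_2(F_2^{\#}F_2)^{\frac i2}+\sum_{\substack{0\le i\le\omega \\ i\text{ odd}}}\begin{bmatrix} N_{0,i}^{\#} \\ D_{0,i}^{\#} \end{bmatrix}Z_2^{\#}F_2(F_2^{\#}F_2)^{\frac{i-1}2},$$ where $Z_1,Z_2\in\mathbf{C}^{m\times p}$ are arbitrary matrices; that is, in each case the solutions are exactly those of the stated form.
   Context: $A^{\#}$ denotes the entrywise complex conjugate of $A$. For a polynomial matrix $P(s)$, $s$ is treated as a real parameter when conjugating ($s^{\#}=s$), so $P^{\#}(s)$ is obtained by conjugating the coefficients only. Here $x^+$ denotes $\dot x(t)$ or $x(t+1)$; controllability of $x^+=A_2^{\#}x^{\#}+B_2^{\#}u^{\#}$ is equivalent to controllability of the matrix pair $\left(\begin{bmatrix} 0 & A_2^{\#} \\ A_2 & 0 \end{bmatrix},\begin{bmatrix} 0 & B_2^{\#} \\ B_2 & 0 \end{bmatrix}\right)$, i.e. $\mathrm{rank}\begin{bmatrix} sI_n & -A_2^{\#} & 0 & B_2^{\#} \\ -A_2 & sI_n & B_2 & 0 \end{bmatrix}=2n$ for all $s\in\mathbf{C}$. The two equations are the generalized Sylvester bimatrix equation of the antilinear system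 in the case $F_1=0_{p\times p}$. *)

theory Defs
  imports "HOL-Analysis.Analysis" "HOL-Computational_Algebra.Computational_Algebra"
begin

text \<open>
  An \<open>r \<times> c\<close> matrix is a value of type \<open>'a ^ 'c ^ 'r\<close>; a polynomial matrix is a matrix over
  \<^typ>\<open>complex poly\<close>. Juxtaposed blocks are indexed by sum types.
\<close>

definition vstack :: "'a ^ 'c ^ 'r1 \<Rightarrow> 'a ^ 'c ^ 'r2 \<Rightarrow> 'a ^ 'c ^ ('r1 + 'r2)"
  where "vstack A B = (\<chi> i. case i of Inl a \<Rightarrow> A $ a | Inr b \<Rightarrow> B $ b)"

definition hstack :: "'a ^ 'c1 ^ 'r \<Rightarrow> 'a ^ 'c2 ^ 'r \<Rightarrow> 'a ^ ('c1 + 'c2) ^ 'r"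
  where "hstack A B = (\<chi> i j. case j of Inl a \<Rightarrow> A $ i $ a | Inr b \<Rightarrow> B $ i $ b)"

primrec matpow :: "'a::semiring_1 ^ 'n ^ 'n \<Rightarrow> nat \<Rightarrow> 'a ^ 'n ^ 'n"
  where
    "matpow A 0 = mat 1"
  | "matpow A (Suc k) = matpow A k ** A"

definition conj_vec :: "complex ^ 'n \<Rightarrow> complex ^ 'n"
  where "conj_vec x = (\<chi> i. cnj (x $ i))"

definition conj_mat :: "complex ^ 'c ^ 'r \<Rightarrow> complex ^ 'c ^ 'r"
  where "conj_mat A = map_matrix cnj A"

text \<open>
  Only the coefficients are conjugated: at a complex point \<open>s\<close>, \<open>P\<^sup>#(s)\<close> is in general not the
  conjugate of \<open>P(s)\<close>.
\<close>

definition conj_pmat :: "complex poly ^ 'c ^ 'r \<Rightarrow> complex poly ^ 'c ^ 'r"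
  where "conj_pmat P = map_matrix (map_poly cnj) P"

definition const_pmat :: "complex ^ 'c ^ 'r \<Rightarrow> complex poly ^ 'c ^ 'r"
  where "const_pmat A = map_matrix (\<lambda>c. [:c:]) A"

definition monom_pmat :: "complex ^ 'c ^ 'r \<Rightarrow> nat \<Rightarrow> complex poly ^ 'c ^ 'r"
  where "monom_pmat C i = map_matrix (\<lambda>c. monom c i) C"

definition eval_pmat :: "complex poly ^ 'c ^ 'r \<Rightarrow> complex \<Rightarrow> complex ^ 'c ^ 'r"
  where "eval_pmat P s = map_matrix (\<lambda>p. poly p s) P"

text \<open>
  The antilinear system \<open>x\<^sup>+ = A\<^sup># x\<^sup># + B\<^sup># u\<^sup>#\<close>, where \<open>x\<^sup>+\<close> is the derivative of \<open>x\<close> in continuous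
  time and the shift of \<open>x\<close> in discrete time.
\<close>

datatype time_domain = Continuous | Discrete

definition antilinear_rhs ::
    "complex ^ 'n ^ 'n \<Rightarrow> complex ^ 'm ^ 'n \<Rightarrow> complex ^ 'n \<Rightarrow> complex ^ 'm \<Rightarrow> complex ^ 'n"
  where "antilinear_rhs A B x u = conj_mat A *v conj_vec x + conj_mat B *v conj_vec u"

text \<open>
  In continuous time the inputs are continuous off a finite set and the states are continuous;
  \<open>S\<close> collects the switching times, at which the differential equation is not imposed.
\<close>

definition ct_trajectory ::
    "complex ^ 'n ^ 'n \<Rightarrow> complex ^ 'm ^ 'n \<Rightarrow> real \<Rightarrow>
      (real \<Rightarrow> complex ^ 'n) \<Rightarrow> (real \<Rightarrow> complex ^ 'm) \<Rightarrow> bool"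
  where
    "ct_trajectory A B T x u \<longleftrightarrow>
      continuous_on {0..T} x \<and>
      (\<exists>S. finite S \<and> continuous_on ({0..T} - S) u \<and>
        (\<forall>t\<in>{0..T} - S.
          (x has_vector_derivative antilinear_rhs A B (x t) (u t)) (at t within {0..T})))"

definition dt_trajectory ::
    "complex ^ 'n ^ 'n \<Rightarrow> complex ^ 'm ^ 'n \<Rightarrow> nat \<Rightarrow>
      (nat \<Rightarrow> complex ^ 'n) \<Rightarrow> (nat \<Rightarrow> complex ^ 'm) \<Rightarrow> bool"
  where
    "dt_trajectory A B T x u \<longleftrightarrow> (\<forall>t<T. x (Suc t) = antilinear_rhs A B (x t) (u t))"

text \<open>
  Controllability is the possibility of steering any state to any other state in finite time.
  In discrete time the target has to be arbitrary: steering to the origin alone is weaker.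
\<close>

fun antilinear_controllable ::
    "time_domain \<Rightarrow> complex ^ 'n ^ 'n \<Rightarrow> complex ^ 'm ^ 'n \<Rightarrow> bool"
  where
    "antilinear_controllable Continuous A B \<longleftrightarrow>
      (\<forall>a b. \<exists>T>0. \<exists>x u. ct_trajectory A B T x u \<and> x 0 = a \<and> x T = b)"
  | "antilinear_controllable Discrete A B \<longleftrightarrow>
      (\<forall>a b. \<exists>T x u. dt_trajectory A B T x u \<and> x 0 = a \<and> x T = b)"

end

theory Submission
  imports Defs
begin

text \<open>
  Let \<open>twist F Z = Z\<^sup># F\<close>. Its square is right multiplication by \<open>F\<^sup># F\<close>, so the proposed solutions
  are \<open>\<Sum>i. C\<^sub>i (twist F)\<^sup>i Z\<close> with \<open>C\<^sub>i\<close> the stacked coefficients of \<open>N\<^sub>0\<close> and \<open>D\<^sub>0\<close>, and the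
  factorization, compared coefficientwise, shows that they solve \<open>A X + B Y = X\<^sup># F\<close>. There are no
  others, by a count of real dimensions. The map \<open>(X, Y) \<mapsto> A X + B Y - X\<^sup># F\<close> is onto: the
  columns \<open>b\<close> for which every \<open>b m\<close> (\<open>m\<close> a row) is hit form a complex subspace that contains
  the range of \<open>B\<close> and is closed under \<open>b \<mapsto> A b\<^sup>#\<close>, and controllability forces such a subspace to
  be everything. The map from \<open>Z\<close> to the solution is injective: if \<open>Z\<close> is in its kernel, then the
  pair of \<open>Z\<close> and \<open>W = Z\<^sup># F\<close> satisfies two complex linear equations that are stable under right
  multiplication by \<open>F\<^sup># F\<close>; on a common eigenvector with eigenvalue \<open>\<mu>\<^sup>2\<close> they become the rank
  condition at \<open>s = \<mu>\<close>. The second equation of the statement is this one for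
  the conjugated data, the first is its conjugate.
\<close>

section \<open>Matrix algebra, conjugation and block matrices\<close>

lemma matrix_add_rdistrib:
  fixes A :: "'a::semiring_1 ^ 'q ^ 'r"
  shows "(A + B) ** C = A ** C + B ** C"
  by (simp add: vec_eq_iff matrix_matrix_mult_def distrib_right sum.distrib)

lemma sum_matrix_mult:
  fixes M :: "'i \<Rightarrow> 'a::semiring_1 ^ 'q ^ 'r"
  shows "sum M I ** X = (\<Sum>i\<in>I. M i ** X)"
  by (induction I rule: infinite_finite_induct) (simp_all add: matrix_add_rdistrib)

lemma matrix_mult_sum_right:
  fixes X :: "'i \<Rightarrow> 'a::semiring_1 ^ 'q ^ 'r"
  shows "M ** sum X I = (\<Sum>i\<in>I. M ** X i)"
  by (induction I rule: infinite_finite_induct) (simp_all add: matrix_add_ldistrib)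

lemma matrix_diff_rdistrib:
  fixes A :: "'a::ring_1 ^ 'q ^ 'r"
  shows "(A - B) ** C = A ** C - B ** C"
  by (simp add: vec_eq_iff matrix_matrix_mult_def left_diff_distrib sum_subtractf)

lemma matrix_diff_ldistrib:
  fixes A :: "'a::ring_1 ^ 'q ^ 'r"
  shows "A ** (B - C) = A ** B - A ** C"
  by (simp add: vec_eq_iff matrix_matrix_mult_def right_diff_distrib sum_subtractf)

lemma matrix_mult_minus_left: "(- A) ** B = - (A ** B)"
  for A :: "'a::ring_1 ^ 'q ^ 'r"
  using matrix_diff_rdistrib[of 0 A B] by simp

lemma matrix_mult_minus_right: "A ** (- B) = - (A ** B)"
  for A :: "'a::ring_1 ^ 'q ^ 'r"
  using matrix_diff_ldistrib[of A 0 B] by simp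

lemma matrix_mult_scaleR:
  fixes A :: "complex ^ 'q ^ 'r"
  shows "A ** (c *\<^sub>R B) = c *\<^sub>R (A ** B)"
  by (simp add: vec_eq_iff matrix_matrix_mult_def scaleR_sum_right)

lemma mat_mult_nth [simp]:
  fixes M :: "'a::comm_semiring_1 ^ 'q ^ 'r"
  shows "(mat c ** M) $ i $ j = c * M $ i $ j"
  by (simp add: matrix_matrix_mult_def mat_def if_distrib[where f="\<lambda>x. x * _"] sum.delta cong: if_cong)

lemma mult_mat_nth [simp]:
  fixes M :: "'a::comm_semiring_1 ^ 'q ^ 'r"
  shows "(M ** mat c) $ i $ j = M $ i $ j * c"
  by (simp add: matrix_matrix_mult_def mat_def if_distrib[where f="\<lambda>x. _ * x"] sum.delta cong: if_cong)

lemma mat_mult_commute: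
  fixes M :: "'a::comm_semiring_1 ^ 'q ^ 'r"
  shows "mat c ** M = M ** mat c"
  by (simp add: vec_eq_iff mult.commute)

lemma mult_mat_mult:
  fixes A :: "'a::comm_semiring_1 ^ 'q ^ 'r"
  shows "A ** (mat c ** B) = mat c ** (A ** B)"
  by (metis mat_mult_commute matrix_mul_assoc)

lemma conj_mat_nth [simp]: "conj_mat A $ i $ j = cnj (A $ i $ j)"
  by (simp add: conj_mat_def)

lemma conj_mat_conj_mat [simp]: "conj_mat (conj_mat A) = A"
  by (simp add: vec_eq_iff)

lemma conj_mat_0 [simp]: "conj_mat 0 = 0"
  by (simp add: vec_eq_iff)

lemma conj_mat_eq_0_iff [simp]: "conj_mat A = 0 \<longleftrightarrow> A = 0"
  by (simp add: vec_eq_iff)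

lemma conj_mat_add: "conj_mat (A + B) = conj_mat A + conj_mat B"
  by (simp add: vec_eq_iff)

lemma conj_mat_scaleR: "conj_mat (r *\<^sub>R A) = r *\<^sub>R conj_mat A"
  by (simp add: vec_eq_iff)

lemma conj_mat_mult: "conj_mat (A ** B) = conj_mat A ** conj_mat B"
  by (simp add: vec_eq_iff matrix_matrix_mult_def)

lemma conj_mat_vstack: "conj_mat (vstack A B) = vstack (conj_mat A) (conj_mat B)"
  by (simp add: vec_eq_iff vstack_def split: sum.split)

definition upper_rows :: "'a ^ 'c ^ ('r1::finite + 'r2::finite) \<Rightarrow> 'a ^ 'c ^ 'r1"
  where "upper_rows W = (\<chi> i. W $ Inl i)"

definition lower_rows :: "'a ^ 'c ^ ('r1::finite + 'r2::finite) \<Rightarrow> 'a ^ 'c ^ 'r2"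
  where "lower_rows W = (\<chi> i. W $ Inr i)"

lemma upper_rows_vstack [simp]: "upper_rows (vstack A B) = A"
  by (simp add: upper_rows_def vstack_def vec_eq_iff)

lemma lower_rows_vstack [simp]: "lower_rows (vstack A B) = B"
  by (simp add: lower_rows_def vstack_def vec_eq_iff)

lemma vstack_rows [simp]: "vstack (upper_rows W) (lower_rows W) = W"
  by (simp add: lower_rows_def upper_rows_def vstack_def vec_eq_iff split: sum.split)

lemma vstack_eq_iff: "vstack A B = vstack A' B' \<longleftrightarrow> A = A' \<and> B = B'"
  by (metis upper_rows_vstack lower_rows_vstack)

lemma vstack_eq_0_iff: "vstack A B = 0 \<longleftrightarrow> A = 0 \<and> B = 0"
proof -
  have "vstack 0 0 = 0"
    by (simp add: vec_eq_iff vstack_def split: sum.split)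
  then show ?thesis
    by (metis vstack_eq_iff)
qed

lemma vstack_mult: "vstack A B ** M = vstack (A ** M) (B ** M)"
  by (simp add: vec_eq_iff vstack_def matrix_matrix_mult_def split: sum.split)

lemma hstack_mult_vstack: "hstack A B ** vstack X Y = A ** X + B ** Y"
  by (simp add: vec_eq_iff vstack_def hstack_def matrix_matrix_mult_def UNIV_Plus_UNIV[symmetric]
      sum.Plus del: UNIV_Plus_UNIV)

lemma upper_rows_0 [simp]: "upper_rows 0 = 0"
  by (simp add: upper_rows_def vec_eq_iff)

lemma upper_rows_add: "upper_rows (A + B) = upper_rows A + upper_rows B"
  by (simp add: upper_rows_def vec_eq_iff)

lemma upper_rows_scaleR: "upper_rows (r *\<^sub>R A) = r *\<^sub>R upper_rows A"
  by (simp add: upper_rows_def vec_eq_iff)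

lemma upper_rows_sum: "upper_rows (sum M I) = (\<Sum>i\<in>I. upper_rows (M i))"
  by (induction I rule: infinite_finite_induct) (simp_all add: upper_rows_add)

lemma upper_rows_mult: "upper_rows (A ** B) = upper_rows A ** B"
  by (simp add: upper_rows_def vec_eq_iff matrix_matrix_mult_def)

section \<open>The antilinear operator, its powers and polynomials in it\<close>

definition twist :: "complex ^ 'p ^ 'p \<Rightarrow> complex ^ 'p ^ 'r \<Rightarrow> complex ^ 'p ^ 'r"
  where "twist F Z = conj_mat Z ** F"

lemma twist_0 [simp]: "twist F 0 = 0"
  by (simp add: twist_def)

lemma twist_add: "twist F (X + Y) = twist F X + twist F Y"
  by (simp add: twist_def conj_mat_add matrix_add_rdistrib)

lemma twist_scaleR: "twist F (r *\<^sub>R X) = r *\<^sub>R twist F X"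
  by (simp add: twist_def conj_mat_scaleR scalar_matrix_assoc)

lemma twist_sum: "twist F (sum M I) = (\<Sum>i\<in>I. twist F (M i))"
  by (induction I rule: infinite_finite_induct) (simp_all add: twist_add)

lemma twist_mult: "twist F (M ** Z) = conj_mat M ** twist F Z"
  by (simp add: twist_def conj_mat_mult matrix_mul_assoc)

lemma twist_twist: "twist F (twist F Z) = Z ** (conj_mat F ** F)"
  by (simp add: twist_def conj_mat_mult matrix_mul_assoc)

lemma twist_power_add: "(twist F ^^ i) (X + Y) = (twist F ^^ i) X + (twist F ^^ i) Y"
  by (induction i) (simp_all add: twist_add)

lemma twist_power_scaleR: "(twist F ^^ i) (r *\<^sub>R X) = r *\<^sub>R (twist F ^^ i) X"
  by (induction i) (simp_all add: twist_scaleR)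

lemma matpow_commute:
  assumes "G ** H = H ** G"
  shows "matpow G k ** H = H ** matpow G k"
proof (induction k)
  case (Suc k)
  then show ?case
    by (metis assms matpow.simps(2) matrix_mul_assoc)
qed simp

text \<open>The powers of \<open>twist F\<close> alternate between right multiples of
  \<open>Z\<close> and of \<open>twist F Z\<close>. Making the second matrix an independent argument
  \<open>W\<close> yields an expression that is complex linear in the pair.\<close>

definition twist_pow_pair ::
    "complex ^ 'p ^ 'p \<Rightarrow> nat \<Rightarrow> complex ^ 'p ^ 'r \<Rightarrow> complex ^ 'p ^ 'r \<Rightarrow> complex ^ 'p ^ 'r"
  where "twist_pow_pair G i Z W =
    (if even i then Z ** matpow G (i div 2) else W ** matpow G ((i - 1) div 2))"

lemma twist_power:
  "(twist F ^^ i) Z = twist_pow_pair (conj_mat F ** F) i Z (twist F Z)"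
proof (induction i arbitrary: Z)
  case 0
  then show ?case
    by (simp add: twist_pow_pair_def)
next
  case (Suc i)
  let ?G = "conj_mat F ** F"
  \<comment> \<open>\<open>matpow\<close> appends factors on the right, while
    \<open>twist_twist\<close> leaves the new factor in front of the power.\<close>
  have G: "?G ** matpow ?G k = matpow ?G (Suc k)" for k
    using matpow_commute[of ?G ?G k] by simp
  \<comment> \<open>Peeling off the innermost application replaces the pair \<open>Z\<close>,
    \<open>twist F Z\<close> by \<open>twist F Z\<close>, \<open>Z ** ?G\<close>; hence the
    induction over arbitrary \<open>Z\<close>.\<close>
  have "(twist F ^^ Suc i) Z = twist_pow_pair ?G i (twist F Z) (twist F (twist F Z))"
    by (simp only: funpow_Suc_right o_apply Suc.IH)
  also have "\<dots> = twist_pow_pair ?G (Suc i) Z (twist F Z)"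
  proof (cases "even i")
    case True
    then show ?thesis by (simp add: twist_pow_pair_def)
  next
    case False
    then obtain k where "i = 2 * k + 1" by (auto elim: oddE)
    then show ?thesis
      by (simp add: twist_pow_pair_def twist_twist G matrix_mul_assoc[of Z ?G, symmetric]
          del: matpow.simps)
  qed
  finally show ?case .
qed

definition twist_poly ::
    "(nat \<Rightarrow> complex ^ 'm ^ 'r) \<Rightarrow> nat \<Rightarrow> complex ^ 'p ^ 'p \<Rightarrow> complex ^ 'p ^ 'm \<Rightarrow> complex ^ 'p ^ 'r"
  where "twist_poly C k F Z = (\<Sum>i\<le>k. C i ** (twist F ^^ i) Z)"

lemma twist_poly_even_odd:
  "twist_poly C k F Z =
    (\<Sum>i | i \<le> k \<and> even i. C i ** Z ** matpow (conj_mat F ** F) (i div 2)) +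
    (\<Sum>i | i \<le> k \<and> odd i. C i ** conj_mat Z ** F ** matpow (conj_mat F ** F) ((i - 1) div 2))"
proof -
  have "{..k} = {i. i \<le> k \<and> even i} \<union> {i. i \<le> k \<and> odd i}"
    by auto
  then have "twist_poly C k F Z =
      (\<Sum>i | i \<le> k \<and> even i. C i ** (twist F ^^ i) Z) +
      (\<Sum>i | i \<le> k \<and> odd i. C i ** (twist F ^^ i) Z)"
    unfolding twist_poly_def by (metis (no_types, lifting) sum.union_disjoint
      finite_Un finite_atMost disjoint_iff mem_Collect_eq)
  moreover have "(\<Sum>i | i \<le> k \<and> even i. C i ** (twist F ^^ i) Z) =
      (\<Sum>i | i \<le> k \<and> even i. C i ** Z ** matpow (conj_mat F ** F) (i div 2))"
    by (rule sum.cong) (simp_all add: twist_power twist_pow_pair_def matrix_mul_assoc)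
  moreover have "(\<Sum>i | i \<le> k \<and> odd i. C i ** (twist F ^^ i) Z) =
      (\<Sum>i | i \<le> k \<and> odd i.
        C i ** conj_mat Z ** F ** matpow (conj_mat F ** F) ((i - 1) div 2))"
    by (rule sum.cong) (simp_all add: twist_power twist_pow_pair_def twist_def matrix_mul_assoc)
  ultimately show ?thesis
    by simp
qed

text \<open>Linearity is over the reals: odd powers of \<open>twist F\<close> are conjugate-linear.
  The dimension count is therefore a real one.\<close>

lemma linear_twist_poly: "linear (twist_poly C k F)"
proof
  fix X Y r
  show "twist_poly C k F (X + Y) = twist_poly C k F X + twist_poly C k F Y"
    by (simp add: twist_poly_def twist_power_add matrix_add_ldistrib sum.distrib)
  show "twist_poly C k F (r *\<^sub>R X) = r *\<^sub>R twist_poly C k F X"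
    by (simp add: twist_poly_def twist_power_scaleR matrix_mult_scaleR scaleR_sum_right)
qed

text \<open>An index shift: the recursion trades \<open>M\<close> for one more application of
  \<open>twist F\<close>, and the two boundary conditions remove the terms at either end.\<close>

lemma twist_poly_solves:
  fixes C :: "nat \<Rightarrow> complex ^ 'm ^ ('n::finite + 'l::finite)"
  assumes "M ** C 0 = 0"
    and "\<And>i. i < k \<Longrightarrow> M ** C (Suc i) = conj_mat (upper_rows (C i))"
    and "upper_rows (C k) = 0"
  shows "M ** twist_poly C k F Z = twist F (upper_rows (twist_poly C k F Z))"
proof -
  have "M ** twist_poly C k F Z = (\<Sum>i\<le>k. (M ** C i) ** (twist F ^^ i) Z)"
    by (simp add: twist_poly_def matrix_mult_sum_right matrix_mul_assoc)
  also have "\<dots> = (\<Sum>i<k. conj_mat (upper_rows (C i)) ** (twist F ^^ Suc i) Z)"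
    by (simp add: sum.atMost_shift assms(1,2) del: funpow.simps)
  \<comment> \<open>The added term \<open>i = k\<close> vanishes because
    \<open>upper_rows (C k) = 0\<close>.\<close>
  also have "\<dots> = (\<Sum>i\<le>k. conj_mat (upper_rows (C i)) ** (twist F ^^ Suc i) Z)"
    by (simp add: lessThan_Suc_atMost[symmetric] assms(3))
  also have "\<dots> = twist F (upper_rows (twist_poly C k F Z))"
    by (simp add: twist_poly_def upper_rows_sum upper_rows_mult twist_sum twist_mult)
  finally show ?thesis .
qed

section \<open>Controllability and invariant subspaces\<close>

text \<open>A Gronwall argument for the component of \<open>x\<close> orthogonal to
  \<open>S\<close>, which starts at 0 and solves a homogeneous linear equation off \<open>E\<close>.
  Prescribing the derivative only modulo \<open>S\<close> leaves room for an input term.\<close>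

lemma subspace_invariant_ode:
  fixes x :: "real \<Rightarrow> 'a::euclidean_space" and f :: "'a \<Rightarrow> 'a"
  assumes S: "subspace S" and f: "linear f" "\<And>v. v \<in> S \<Longrightarrow> f v \<in> S"
    and T: "0 \<le> T" and cont: "continuous_on {0..T} x" and fin: "finite E"
    and deriv: "\<And>t. t \<in> {0..T} - E \<Longrightarrow>
      \<exists>d. (x has_vector_derivative d) (at t within {0..T}) \<and> d - f (x t) \<in> S"
    and init: "x 0 \<in> S"
  shows "x T \<in> S"
proof -
  obtain B where B: "B \<subseteq> S" "pairwise orthogonal B" "\<And>b. b \<in> B \<Longrightarrow> norm b = 1"
      "independent B" "span B = S"
    using orthonormal_basis_subspace[OF S] by metis
  have finB: "finite B"
    using B(4) by (rule independent_imp_finite)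
  \<comment> \<open>\<open>p\<close> is the orthogonal projection with kernel
    \<open>S\<close>.\<close>
  define p where "p v = v - (\<Sum>b\<in>B. (v \<bullet> b) *\<^sub>R b)" for v
  have linp: "linear p"
    by (rule linearI)
      (simp_all add: p_def inner_add_left scaleR_add_left sum.distrib scaleR_sum_right algebra_simps)
  have diff: "v - p v \<in> S" for v
    unfolding p_def using B(1) by (auto intro!: subspace_sum subspace_scale S)
  have zero: "p v = 0" if "v \<in> S" for v
  proof -
    have "p b = 0" if b: "b \<in> B" for b
    proof -
      have "(\<Sum>c\<in>B. (b \<bullet> c) *\<^sub>R c) = (\<Sum>c\<in>B. if c = b then b else 0)"
      proof (rule sum.cong[OF refl])
        fix c assume "c \<in> B"
        show "(b \<bullet> c) *\<^sub>R c = (if c = b then b else 0)"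
        proof (cases "c = b")
          case True
          then show ?thesis using B(3)[OF b] by (simp add: norm_eq_1)
        next
          case False
          then have "b \<bullet> c = 0"
            using B(2) b \<open>c \<in> B\<close> by (auto simp: pairwise_def orthogonal_def)
          then show ?thesis using False by simp
        qed
      qed
      then show ?thesis using b finB by (simp add: p_def)
    qed
    then show ?thesis
      using linear_eq_0_on_span[OF linp] that B(5) by blast
  qed
  \<comment> \<open>As \<open>f\<close> preserves \<open>S\<close> and \<open>p\<close> kills it,
    \<open>h v\<close> depends on \<open>p v\<close> alone, so \<open>y\<close> below obeys an
    equation of its own.\<close>
  define h where "h v = p (f v)" for v
  have linh: "linear h"
    unfolding h_def using linear_compose[OF f(1) linp] by (simp add: o_def)
  have h_p: "h (p v) = h v" for v
  proof -
    have "h v - h (p v) = h (v - p v)"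
      by (simp add: linear_diff[OF linh])
    also have "\<dots> = 0"
      using diff f(2) zero by (simp add: h_def)
    finally show ?thesis by simp
  qed
  obtain K where K: "\<And>v. norm (h v) \<le> K * norm v"
    using linear_bounded[OF linh] by blast
  define y where "y t = p (x t)" for t
  \<comment> \<open>Since \<open>K\<close> bounds \<open>h\<close>, the squared norm of
    \<open>y\<close> times \<open>exp (- 2 * K * t)\<close> cannot grow. The minus sign makes the
    derivative \<open>g'\<close> nonnegative, and with it its integral.\<close>
  define g where "g t = - ((y t \<bullet> y t) * exp (- 2 * K * t))" for t
  define g' where
    "g' t = - (2 * (y t \<bullet> h (y t)) * exp (- 2 * K * t) - 2 * K * (y t \<bullet> y t) * exp (- 2 * K * t))" for t
  have blp: "bounded_linear p"
    using linp by (simp add: linear_linear)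
  have cont_y: "continuous_on {0..T} y"
    unfolding y_def using cont by (intro bounded_linear.continuous_on[OF blp])
  have dy: "(y has_vector_derivative h (y t)) (at t)" if t: "t \<in> {0<..<T} - E" for t
  proof -
    obtain d where d: "(x has_vector_derivative d) (at t within {0..T})" "d - f (x t) \<in> S"
      using deriv[of t] t by auto
    have "(x has_vector_derivative d) (at t)"
      using d(1) t by (simp add: at_within_Icc_at)
    then have "(y has_vector_derivative p d) (at t)"
      unfolding y_def by (rule bounded_linear.has_vector_derivative[OF blp])
    moreover have "p d = h (y t)"
      using zero[OF d(2)] by (simp add: linear_diff[OF linp] y_def h_p) (simp add: h_def)
    ultimately show ?thesis by simp
  qed
  \<comment> \<open>This form of the fundamental theorem of calculus permits a finite exceptional
    set, here \<open>E\<close>.\<close>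
  have "(g' has_integral (g T - g 0)) {0..T}"
  proof (rule fundamental_theorem_of_calculus_interior_strong[OF fin T])
    show "continuous_on {0..T} g"
      unfolding g_def by (intro continuous_intros cont_y)
    fix t assume t: "t \<in> {0<..<T} - E"
    have "((\<lambda>t. y t \<bullet> y t) has_vector_derivative (y t \<bullet> h (y t) + h (y t) \<bullet> y t)) (at t)"
      using bounded_bilinear.has_vector_derivative[OF bounded_bilinear_inner dy[OF t] dy[OF t]] .
    then have "((\<lambda>t. y t \<bullet> y t) has_real_derivative 2 * (y t \<bullet> h (y t))) (at t)"
      by (simp add: has_real_derivative_iff_has_vector_derivative inner_commute)
    then have "(g has_real_derivative g' t) (at t)"
      unfolding g_def g'_def
      by (auto intro!: derivative_eq_intros simp: algebra_simps)
    then show "(g has_vector_derivative g' t) (at t)"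
      by (simp add: has_real_derivative_iff_has_vector_derivative)
  qed
  moreover have "0 \<le> g' t" for t
  proof -
    have "y t \<bullet> h (y t) \<le> norm (y t) * norm (h (y t))"
      by (rule norm_cauchy_schwarz)
    also have "\<dots> \<le> norm (y t) * (K * norm (y t))"
      by (intro mult_left_mono K) simp
    also have "\<dots> = K * (y t \<bullet> y t)"
      by (simp add: dot_square_norm power2_eq_square)
    finally have "y t \<bullet> h (y t) * exp (- 2 * K * t) \<le> K * (y t \<bullet> y t) * exp (- 2 * K * t)"
      by (intro mult_right_mono) simp_all
    then show ?thesis by (simp add: g'_def)
  qed
  ultimately have "0 \<le> g T - g 0"
    using has_integral_nonneg by blast
  moreover have "g 0 = 0"
    using zero[OF init] by (simp add: g_def y_def)
  ultimately have "(y T \<bullet> y T) * exp (- 2 * K * T) \<le> 0"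
    by (simp add: g_def)
  then have "y T \<bullet> y T \<le> 0"
    by (simp add: mult_le_0_iff)
  then have "y T = 0"
    by (metis inner_ge_zero inner_eq_zero_iff order_antisym)
  then show ?thesis
    using diff[of "x T"] by (simp add: y_def)
qed

text \<open>A subspace criterion that extracts from both time domains what surjectivity requires.
  The system conjugates its matrices, so its instance has \<open>conj_mat A\<close> and
  \<open>conj_mat B\<close> as arguments.\<close>

definition antilinear_reachable ::
    "complex ^ 'n ^ 'n \<Rightarrow> complex ^ 'm ^ 'n \<Rightarrow> bool"
  where "antilinear_reachable A B \<longleftrightarrow>
    (\<forall>S. vec.subspace S \<and> (\<forall>u. B *v u \<in> S) \<and> (\<forall>a\<in>S. A *v conj_vec a \<in> S) \<longrightarrow> S = UNIV)"

lemma conj_vec_conj_vec [simp]: "conj_vec (conj_vec a) = a"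
  by (simp add: conj_vec_def vec_eq_iff)

lemma conj_vec_0 [simp]: "conj_vec 0 = 0"
  by (simp add: conj_vec_def vec_eq_iff)

lemma conj_vec_add: "conj_vec (a + b) = conj_vec a + conj_vec b"
  by (simp add: conj_vec_def vec_eq_iff)

lemma conj_vec_scale: "conj_vec (c *s a) = cnj c *s conj_vec a"
  by (simp add: conj_vec_def vec_eq_iff)

lemma conj_vec_mult: "conj_vec (A *v a) = conj_mat A *v conj_vec a"
  by (simp add: conj_vec_def vec_eq_iff matrix_vector_mult_def)

text \<open>A trajectory from the origin never leaves an invariant subspace that contains the input
  directions, yet controllability lets it end at any \<open>b\<close>.\<close>

lemma controllable_imp_reachable:
  fixes A :: "complex ^ 'n ^ 'n" and B :: "complex ^ 'm ^ 'n"
  assumes "antilinear_controllable td A B"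
  shows "antilinear_reachable (conj_mat A) (conj_mat B)"
  unfolding antilinear_reachable_def
proof safe
  fix S :: "(complex ^ 'n) set" and b :: "complex ^ 'n"
  assume S: "vec.subspace S" and SB: "\<forall>u. conj_mat B *v u \<in> S"
    and SA: "\<forall>a\<in>S. conj_mat A *v conj_vec a \<in> S"
  have rhs: "antilinear_rhs A B x u \<in> S" if "x \<in> S" for x u
    unfolding antilinear_rhs_def using SA SB that by (intro vec.subspace_add S) auto
  show "b \<in> S"
  proof (cases td)
    case Discrete
    then have "\<exists>T x u. dt_trajectory A B T x u \<and> x 0 = 0 \<and> x T = b"
      using assms by simp
    then obtain T x u where xu: "dt_trajectory A B T x u" "x 0 = 0" "x T = b"
      by blast
    have "t \<le> T \<Longrightarrow> x t \<in> S" for t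
    proof (induction t)
      case 0
      then show ?case using xu S by (simp add: vec.subspace_0)
    next
      case (Suc t)
      then show ?case using xu(1) rhs by (simp add: dt_trajectory_def)
    qed
    then show ?thesis using xu(3) by auto
  next
    case Continuous
    then have "\<exists>T>0. \<exists>x u. ct_trajectory A B T x u \<and> x 0 = 0 \<and> x T = b"
      using assms by simp
    then obtain T x u where T: "T > 0" and tr: "ct_trajectory A B T x u" and x: "x 0 = 0" "x T = b"
      by blast
    obtain E where E: "finite E" "\<And>t. t \<in> {0..T} - E \<Longrightarrow>
        (x has_vector_derivative antilinear_rhs A B (x t) (u t)) (at t within {0..T})"
      and cont: "continuous_on {0..T} x"
      using tr unfolding ct_trajectory_def by blast
    have scaleR: "r *\<^sub>R a = complex_of_real r *s a" for r and a :: "complex ^ 'n"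
      by (simp add: vec_eq_iff) (simp add: scaleR_conv_of_real)
    \<comment> \<open>The complex subspace serves as a real one and the drift is real linear; the
      input term lies in \<open>S\<close>, so it is absorbed by the freedom in the
      derivative.\<close>
    have "x T \<in> S"
    proof (rule subspace_invariant_ode[where f = "\<lambda>v. conj_mat A *v conj_vec v" and E = E])
      show "subspace S"
        using S by (auto simp: subspace_def vec.subspace_def scaleR)
      show "linear (\<lambda>v. conj_mat A *v conj_vec v)"
        by (rule linearI)
          (simp_all add: conj_vec_add matrix_vector_right_distrib scaleR conj_vec_scale
            vector_scalar_commute)
      show "\<exists>d. (x has_vector_derivative d) (at t within {0..T}) \<and>
          d - conj_mat A *v conj_vec (x t) \<in> S" if "t \<in> {0..T} - E" for t
        using E(2)[OF that] SB by (auto simp: antilinear_rhs_def intro!: exI)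
    qed (use SA T E cont x S in \<open>auto simp: vec.subspace_0\<close>)
    then show ?thesis using x by simp
  qed
qed simp

text \<open>The preimage of an invariant complex subspace under entrywise conjugation is again a
  complex subspace, invariant for the conjugated data.\<close>

lemma reachable_conj:
  assumes "antilinear_reachable (conj_mat A) (conj_mat B)"
  shows "antilinear_reachable A B"
  unfolding antilinear_reachable_def
proof (intro allI impI)
  fix S assume S: "vec.subspace S \<and> (\<forall>u. B *v u \<in> S) \<and> (\<forall>a\<in>S. A *v conj_vec a \<in> S)"
  have "vec.subspace {a. conj_vec a \<in> S}"
    using S by (auto simp: vec.subspace_def conj_vec_add conj_vec_scale)
  moreover have "conj_vec (conj_mat B *v u) \<in> S" for u
    using S by (simp add: conj_vec_mult)
  moreover have "conj_vec (conj_mat A *v conj_vec a) \<in> S" if "conj_vec a \<in> S" for a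
  proof -
    have "A *v conj_vec (conj_vec a) \<in> S" using S that by blast
    then show ?thesis by (simp add: conj_vec_mult)
  qed
  ultimately have "{a. conj_vec a \<in> S} = UNIV"
    using assms unfolding antilinear_reachable_def by simp
  then have "conj_vec (conj_vec a) \<in> S" for a
    by blast
  then show "S = UNIV" by auto
qed

section \<open>Surjectivity of the Sylvester operator\<close>

definition sylvester_map ::
    "complex ^ 'n ^ 'n \<Rightarrow> complex ^ 'm ^ 'n \<Rightarrow> complex ^ 'p ^ 'p \<Rightarrow>
      complex ^ 'p ^ ('n + 'm) \<Rightarrow> complex ^ 'p ^ 'n"
  where "sylvester_map A B F W = hstack A B ** W - twist F (upper_rows W)"

lemma linear_sylvester_map: "linear (sylvester_map A B F)"
  by (rule linearI)
    (simp_all add: sylvester_map_def matrix_add_ldistrib upper_rows_add twist_add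
      upper_rows_scaleR twist_scaleR matrix_mult_scaleR scaleR_diff_right)

definition outer_prod :: "complex ^ 'r \<Rightarrow> complex ^ 'p \<Rightarrow> complex ^ 'p ^ 'r"
  where "outer_prod b m = (\<chi> i j. b $ i * m $ j)"

lemma mult_outer_prod: "A ** outer_prod b m = outer_prod (A *v b) m"
  by (simp add: outer_prod_def vec_eq_iff matrix_matrix_mult_def matrix_vector_mult_def
      sum_distrib_right mult.assoc)

lemma twist_outer_prod: "twist F (outer_prod (conj_vec b) m) = outer_prod b (conj_vec m v* F)"
  by (simp add: twist_def outer_prod_def vec_eq_iff matrix_matrix_mult_def vector_matrix_mult_def
      conj_vec_def sum_distrib_left mult.assoc mult.left_commute)

lemma surj_sylvester_map:
  fixes A :: "complex ^ 'n ^ 'n" and B :: "complex ^ 'm ^ 'n" and F :: "complex ^ 'p ^ 'p"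
  assumes "antilinear_reachable A B"
  shows "surj (sylvester_map A B F)"
proof -
  define I where "I = range (sylvester_map A B F)"
  have I: "subspace I"
    unfolding I_def by (intro linear_subspace_image linear_sylvester_map subspace_UNIV)
  \<comment> \<open>\<open>I\<close> is known to be closed under real scalars only. Quantifying over
    every \<open>m\<close> makes \<open>S\<close> a complex subspace, since a complex factor of
    \<open>b\<close> can be moved to \<open>m\<close>.\<close>
  define S where "S = {b. \<forall>m. outer_prod b m \<in> I}"
  have "vec.subspace S"
  proof (rule vec.subspaceI)
    have "outer_prod (0 :: complex ^ 'n) m = 0" for m :: "complex ^ 'p"
      by (simp add: outer_prod_def vec_eq_iff)
    then have "outer_prod 0 m \<in> I" for m
      using subspace_0[OF I] by metis
    then show "0 \<in> S" unfolding S_def by blast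
    have "outer_prod (a + b) m = outer_prod a m + outer_prod b m" for a b :: "complex ^ 'n" and m :: "complex ^ 'p"
      by (simp add: outer_prod_def vec_eq_iff algebra_simps)
    then show "a \<in> S \<Longrightarrow> b \<in> S \<Longrightarrow> a + b \<in> S" for a b
      using I by (simp add: S_def subspace_add)
    have "outer_prod (c *s a) m = outer_prod a (c *s m)" for c and a :: "complex ^ 'n" and m :: "complex ^ 'p"
      by (simp add: outer_prod_def vec_eq_iff algebra_simps)
    then show "a \<in> S \<Longrightarrow> c *s a \<in> S" for c a
      by (simp add: S_def)
  qed
  moreover have "B *v u \<in> S" for u
  proof -
    have "sylvester_map A B F (vstack 0 (outer_prod u m)) = outer_prod (B *v u) m" for m
      by (simp add: sylvester_map_def hstack_mult_vstack mult_outer_prod)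
    then have "outer_prod (B *v u) m \<in> I" for m
      unfolding I_def by (metis rangeI)
    then show ?thesis unfolding S_def by blast
  qed
  moreover have "A *v conj_vec a \<in> S" if a: "a \<in> S" for a
  proof -
    \<comment> \<open>The trial value of \<open>X\<close> is chosen so that its twist is an outer
      product with column \<open>a\<close>, which lies in \<open>I\<close> because \<open>a\<close>
      is in \<open>S\<close>.\<close>
    have "sylvester_map A B F (vstack (outer_prod (conj_vec a) m) 0) + outer_prod a (conj_vec m v* F)
        = outer_prod (A *v conj_vec a) m" for m
      by (simp add: sylvester_map_def hstack_mult_vstack mult_outer_prod twist_outer_prod)
    moreover have "sylvester_map A B F (vstack (outer_prod (conj_vec a) m) 0)
        + outer_prod a (conj_vec m v* F) \<in> I" for m
      using a by (intro subspace_add[OF I]) (auto simp: S_def I_def)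
    ultimately show ?thesis by (simp add: S_def)
  qed
  ultimately have S: "S = UNIV"
    using assms unfolding antilinear_reachable_def by blast
  have "R \<in> I" for R
  proof -
    have "R = (\<Sum>i\<in>UNIV. outer_prod (axis i 1) (R $ i))"
      by (simp add: vec_eq_iff outer_prod_def axis_def if_distrib[where f="\<lambda>x. x * _"] cong: if_cong)
    also have "\<dots> \<in> I"
      using S by (intro subspace_sum[OF I]) (auto simp: S_def)
    finally show ?thesis .
  qed
  then show ?thesis unfolding I_def by blast
qed

section \<open>Kernel and range by counting dimensions\<close>

text \<open>With a right inverse \<open>h\<close> of \<open>f\<close>, the map from
  \<open>(z, y)\<close> to \<open>g z + h y\<close> is injective between spaces of equal dimension,
  hence onto. Applying \<open>f\<close> to such a decomposition of \<open>x\<close> recovers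
  \<open>y\<close>, which is 0 when \<open>x\<close> is in the kernel.\<close>

lemma kernel_eq_range_of_dims:
  fixes f :: "'a::euclidean_space \<Rightarrow> 'b::euclidean_space" and g :: "'c::euclidean_space \<Rightarrow> 'a"
  assumes f: "linear f" "surj f" and g: "linear g" "inj g"
    and fg: "\<And>z. f (g z) = 0" and dims: "DIM('a) = DIM('c) + DIM('b)"
  shows "f x = 0 \<longleftrightarrow> x \<in> range g"
proof
  assume fx: "f x = 0"
  obtain h where h: "linear h" "f \<circ> h = id"
    using linear_surjective_right_inverse[OF f] by blast
  have fh: "f (h y) = y" for y
    using h(2) by (metis comp_apply id_apply)
  define k where "k = (\<lambda>(z, y). g z + h y)"
  have k: "linear k"
    unfolding k_def
    by (rule linearI) (auto simp: linear_add[OF g(1)] linear_add[OF h(1)]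
        linear_scale[OF g(1)] linear_scale[OF h(1)] algebra_simps)
  have "inj k"
    unfolding linear_injective_0[OF k]
  proof safe
    fix z y assume "k (z, y) = 0"
    then have *: "g z + h y = 0" by (simp add: k_def)
    then have "f (g z + h y) = 0" by (simp add: linear_0[OF f(1)])
    then have "y = 0" by (simp add: linear_add[OF f(1)] fg fh)
    moreover have "z = 0"
      using * \<open>y = 0\<close> g by (simp add: linear_0[OF h(1)] linear_injective_0)
    ultimately show "(z, y) = 0" by (simp add: zero_prod_def)
  qed
  then have "dim (range k) = DIM('c \<times> 'b)"
    using dim_image_eq[OF k] by (simp add: dim_UNIV)
  then have "dim (range k) = DIM('a)"
    using dims by simp
  then have "range k = UNIV"
    using linear_subspace_image[OF k subspace_UNIV] by (metis dim_eq_full span_eq_iff)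
  then obtain z y where zy: "x = g z + h y"
    by (metis (no_types, lifting) k_def rangeE UNIV_I case_prod_beta)
  then have "y = 0"
    using fx by (simp add: linear_add[OF f(1)] fg fh)
  then show "x \<in> range g"
    using zy by (simp add: linear_0[OF h(1)])
qed (use fg in auto)

section \<open>Annihilating polynomials of a matrix\<close>

definition mat_poly :: "complex ^ 'p ^ 'p \<Rightarrow> complex poly \<Rightarrow> complex ^ 'p ^ 'p"
  where "mat_poly G q = fold_coeffs (\<lambda>a M. mat a + G ** M) q 0"

lemma mat_poly_0 [simp]: "mat_poly G 0 = 0"
  by (simp add: mat_poly_def)

lemma mat_poly_pCons [simp]: "mat_poly G (pCons a q) = mat a + G ** mat_poly G q"
  by (cases "a = 0 \<and> q = 0") (auto simp: mat_poly_def fold_coeffs_pCons_not_0_0_eq fold_coeffs_pCons_coeff_not_0_eq)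

lemma mat_add: "mat (a + b) = mat a + mat b"
  for a b :: "'a::monoid_add"
  by (simp add: vec_eq_iff mat_def)

lemma mat_poly_add: "mat_poly G (p + q) = mat_poly G p + mat_poly G q"
  by (induction p q rule: poly_induct2) (simp_all add: mat_add matrix_add_ldistrib)

lemma mat_poly_smult: "mat_poly G (smult c q) = mat c ** mat_poly G q"
proof (induction q)
  case (pCons a q)
  have "mat (c * a) = mat c ** (mat a :: complex ^ 'a ^ 'a)"
    by (simp add: vec_eq_iff) (simp add: mat_def)
  then show ?case
    using pCons by (simp add: matrix_add_ldistrib mult_mat_mult)
qed simp

lemma mat_poly_linear_mult:
  "mat_poly G ([:- c, 1:] * q) = (G - mat c) ** mat_poly G q"
proof -
  have "[:- c, 1:] * q = pCons 0 q + smult (- c) q"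
    by simp
  then have "mat_poly G ([:- c, 1:] * q) = G ** mat_poly G q + mat (- c) ** mat_poly G q"
    by (simp only: mat_poly_add mat_poly_smult mat_poly_pCons) simp
  then show ?thesis
    by (simp add: matrix_diff_rdistrib vec_eq_iff)
qed

lemma mat_poly_commute: "mat_poly G q ** G = G ** mat_poly G q"
  by (induction q) (simp_all add: matrix_add_ldistrib matrix_add_rdistrib mat_mult_commute[of _ G]
      matrix_mul_assoc[symmetric])

lemma mat_poly_monom: "mat_poly G (monom c i) = mat c ** matpow G i"
proof (induction i)
  case (Suc i)
  have "G ** (mat c ** matpow G i) = mat c ** (G ** matpow G i)"
    by (rule mult_mat_mult)
  then show ?case
    using Suc matpow_commute[of G G i] by (simp add: monom_Suc)
qed (simp add: monom_0)

lemma mat_poly_sum: "mat_poly G (sum q I) = (\<Sum>i\<in>I. mat_poly G (q i))"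
  by (induction I rule: infinite_finite_induct) (simp_all add: mat_poly_add)

text \<open>The powers of \<open>G\<close> up to the real dimension of the matrix space are one too
  many to be independent; a real linear relation between them is read as a complex
  polynomial.\<close>

lemma annihilating_poly_exists:
  fixes G :: "complex ^ 'p ^ 'p"
  obtains q where "q \<noteq> 0" "mat_poly G q = 0"
proof (cases "inj_on (matpow G) {..DIM(complex ^ 'p ^ 'p)}")
  \<comment> \<open>Dependence is a property of the set of powers, so coinciding powers are treated
    separately: the difference of the two monomials annihilates \<open>G\<close>.\<close>
  case False
  then obtain i j where "i \<noteq> j" "matpow G i = matpow G j"
    by (auto simp: inj_on_def)
  moreover have "monom 1 i + smult (- 1) (monom 1 j) \<noteq> (0 :: complex poly)" if "i \<noteq> j" for i j
  proof
    assume "monom 1 i + smult (- 1) (monom 1 j) = (0 :: complex poly)"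
    then have "coeff (monom 1 i + smult (- 1) (monom 1 j)) i = (0 :: complex)" by simp
    then show False using that by simp
  qed
  moreover have "mat_poly G (monom 1 i + smult (- 1) (monom 1 j)) = matpow G i - matpow G j" for i j
    by (simp add: mat_poly_add mat_poly_smult mat_poly_monom vec_eq_iff del: smult_monom smult_minus_left)
  ultimately show thesis by (metis that diff_self)
next
  case True
  let ?I = "{..DIM(complex ^ 'p ^ 'p)}"
  have "card (matpow G ` ?I) > DIM(complex ^ 'p ^ 'p)"
    using True by (simp add: card_image)
  then have "dependent (matpow G ` ?I)"
    using dependent_biggerset by blast
  then obtain u v where u: "(\<Sum>v\<in>matpow G ` ?I. u v *\<^sub>R v) = 0" "v \<in> matpow G ` ?I" "u v \<noteq> 0"
    by (auto simp: dependent_finite)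
  then obtain j where j: "j \<in> ?I" "u (matpow G j) \<noteq> 0" by blast
  define q where "q = (\<Sum>i\<in>?I. monom (complex_of_real (u (matpow G i))) i)"
  have "coeff q j \<noteq> 0"
    using j by (simp add: q_def coeff_sum)
  then have "q \<noteq> 0" by auto
  moreover have "mat_poly G q = 0"
  proof -
    have "mat_poly G q = (\<Sum>i\<in>?I. u (matpow G i) *\<^sub>R matpow G i)"
      unfolding q_def mat_poly_sum mat_poly_monom
    proof (rule sum.cong[OF refl])
      show "mat (complex_of_real r) ** M = r *\<^sub>R M" for r and M :: "complex ^ 'p ^ 'p"
        by (simp add: vec_eq_iff) (simp add: scaleR_conv_of_real)
    qed
    also have "\<dots> = 0"
      using u(1) unfolding sum.reindex[OF True] by (simp only: o_def)
    finally show ?thesis .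
  qed
  ultimately show thesis by (rule that)
qed

section \<open>Injectivity of the parametrization\<close>

definition poly_at :: "(nat \<Rightarrow> complex ^ 'm ^ 'r) \<Rightarrow> nat \<Rightarrow> complex \<Rightarrow> complex ^ 'm ^ 'r"
  where "poly_at C k s = (\<Sum>i\<le>k. mat (s ^ i) ** C i)"

lemma poly_at_mult: "poly_at C k s ** a = (\<Sum>i\<le>k. C i ** (mat (s ^ i) ** a))"
  by (simp add: poly_at_def sum_matrix_mult mult_mat_mult matrix_mul_assoc[symmetric])

lemma poly_at_0: "poly_at C k 0 = C 0"
proof -
  have "(\<Sum>i\<le>k. mat (0 ^ i) ** C i) = (\<Sum>i\<le>k. if i = 0 then C 0 else 0)"
    by (rule sum.cong) (auto simp: vec_eq_iff)
  then show ?thesis by (simp add: poly_at_def)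
qed

text \<open>The parameter \<open>W\<close> stands for \<open>twist F Z\<close>: decoupling it from \<open>Z\<close> turns the real linear
  equation \<open>twist_poly C k F Z = 0\<close> and its image under \<open>twist F\<close> into complex linear ones.\<close>

definition twist_kernel ::
    "(nat \<Rightarrow> complex ^ 'm ^ 'r) \<Rightarrow> nat \<Rightarrow> complex ^ 'p ^ 'p \<Rightarrow>
      complex ^ 'p ^ 'm \<Rightarrow> complex ^ 'p ^ 'm \<Rightarrow> bool"
  where "twist_kernel C k G Z W \<longleftrightarrow>
    (\<Sum>i\<le>k. C i ** twist_pow_pair G i Z W) = 0 \<and>
    (\<Sum>i\<le>k. conj_mat (C i) ** twist_pow_pair G i W (Z ** G)) = 0"

lemma twist_pow_pair_mult:
  assumes "G ** H = H ** G"
  shows "twist_pow_pair G i (Z ** H) (W ** H) = twist_pow_pair G i Z W ** H"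
  using matpow_commute[OF assms] by (simp add: twist_pow_pair_def matrix_mul_assoc[symmetric])

text \<open>Both equations involve only right multiplication by powers of \<open>G\<close>, so a
  matrix commuting with \<open>G\<close> can be pulled out on the right.\<close>

lemma twist_kernel_mult:
  assumes "twist_kernel C k G Z W" and GH: "G ** H = H ** G"
  shows "twist_kernel C k G (Z ** H) (W ** H)"
proof -
  have "Z ** H ** G = Z ** G ** H"
    using GH by (simp add: matrix_mul_assoc[symmetric])
  then have "(\<Sum>i\<le>k. C i ** twist_pow_pair G i (Z ** H) (W ** H)) =
      (\<Sum>i\<le>k. C i ** twist_pow_pair G i Z W) ** H"
    "(\<Sum>i\<le>k. conj_mat (C i) ** twist_pow_pair G i (W ** H) (Z ** H ** G)) =
      (\<Sum>i\<le>k. conj_mat (C i) ** twist_pow_pair G i W (Z ** G)) ** H"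
    by (simp_all only: twist_pow_pair_mult[OF GH] sum_matrix_mult matrix_mul_assoc)
  then show ?thesis
    using assms(1) by (simp add: twist_kernel_def)
qed

lemma twist_pow_pair_eigen:
  assumes Z: "Z ** G = mat l ** Z" and W: "W ** G = mat l ** W"
  shows "twist_pow_pair G i Z W =
    (if even i then mat (l ^ (i div 2)) ** Z else mat (l ^ ((i - 1) div 2)) ** W)"
proof -
  have "X ** matpow G j = mat (l ^ j) ** X" if "X ** G = mat l ** X" for X :: "complex ^ 'a ^ 'b" and j
  proof (induction j)
    case (Suc j)
    have "X ** matpow G (Suc j) = mat (l ^ j) ** (X ** G)"
      by (simp add: matrix_mul_assoc Suc)
    also have "\<dots> = mat (l ^ Suc j) ** X"
      by (simp add: that) (simp add: vec_eq_iff)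
    finally show ?case .
  qed simp
  then show ?thesis
    using assms by (simp add: twist_pow_pair_def)
qed

text \<open>The parity split becomes a combination of two geometric sequences: half the sum of
  \<open>\<mu> ^ i\<close> and \<open>(- \<mu>) ^ i\<close> survives for even \<open>i\<close>, half
  the difference for odd \<open>i\<close>, where division by \<open>\<mu>\<close> corrects the
  exponent.\<close>

lemma twist_pow_pair_eigen_sqrt:
  assumes Z: "Z ** G = mat (\<mu>\<^sup>2) ** Z" and W: "W ** G = mat (\<mu>\<^sup>2) ** W" and "\<mu> \<noteq> 0"
  shows "twist_pow_pair G i Z W =
    mat (\<mu> ^ i) ** (mat (1 / 2) ** (Z + mat (1 / \<mu>) ** W)) +
    mat ((- \<mu>) ^ i) ** (mat (1 / 2) ** (Z - mat (1 / \<mu>) ** W))"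
proof (cases "even i")
  case True
  then obtain j where "i = 2 * j" by blast
  then show ?thesis
    by (simp add: twist_pow_pair_eigen[OF Z W] vec_eq_iff power_mult)
      (simp add: add_divide_distrib[symmetric], simp add: algebra_simps)
next
  case False
  then obtain j where "i = 2 * j + 1" by (auto elim: oddE)
  then show ?thesis
    using \<open>\<mu> \<noteq> 0\<close>
    by (simp add: twist_pow_pair_eigen[OF Z W] vec_eq_iff power_mult) (simp add: field_simps)
qed

text \<open>For eigenvalue 0 the two square roots coincide and the splitting above breaks down; what
  remains are the two terms with exponent 0, as \<open>0 ^ 0 = 1\<close>.\<close>

lemma twist_pow_pair_nilpotent:
  assumes Z: "Z ** G = 0" and W: "W ** G = 0"
  shows "twist_pow_pair G i Z W = (if i = 0 then Z else if i = 1 then W else 0)"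
proof -
  have "twist_pow_pair G i Z W =
      (if even i then mat (0 ^ (i div 2)) ** Z else mat (0 ^ ((i - 1) div 2)) ** W)"
    using assms by (intro twist_pow_pair_eigen) auto
  then show ?thesis
    by (auto simp: power_0_left elim!: evenE oddE)
qed

context
  fixes C :: "nat \<Rightarrow> complex ^ 'm ^ 'r" and k :: nat and G :: "complex ^ 'p ^ 'p"
  assumes rank_cond: "\<And>s (a :: complex ^ 'p ^ 'm) b.
      poly_at C k s ** a = poly_at C k (- s) ** b \<Longrightarrow>
      poly_at (\<lambda>i. conj_mat (C i)) k s ** a + poly_at (\<lambda>i. conj_mat (C i)) k (- s) ** b = 0 \<Longrightarrow>
      a = 0 \<and> b = 0"
begin

lemma twist_kernel_eigen:
  assumes ker: "twist_kernel C k G Z W"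
    and Z: "Z ** G = mat l ** Z" and W: "W ** G = mat l ** W"
  shows "Z = 0 \<and> W = 0"
proof (cases "l = 0")
  case True
  then have ZW: "Z ** G = 0" "W ** G = 0" using Z W by auto
  have "(\<Sum>i\<le>k. conj_mat (C i) ** twist_pow_pair G i W (Z ** G)) =
      (\<Sum>i\<le>k. if i = 0 then conj_mat (C 0) ** W else 0)"
    using ZW by (intro sum.cong) (auto simp: twist_pow_pair_nilpotent)
  then have "conj_mat (C 0) ** W = 0"
    using ker by (simp add: twist_kernel_def)
  \<comment> \<open>At \<open>s = 0\<close> both evaluations equal the constant coefficient. Equal
    arguments make the first premise of \<open>rank_cond\<close> trivial; opposite arguments, used
    for \<open>Z\<close> below, do the same for the second.\<close>
  then have "W = 0"
    using rank_cond[of 0 W W] by (simp add: poly_at_0)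
  have "(\<Sum>i\<le>k. C i ** twist_pow_pair G i Z W) = (\<Sum>i\<le>k. if i = 0 then C 0 ** Z else 0)"
    using ZW \<open>W = 0\<close> by (intro sum.cong) (auto simp: twist_pow_pair_nilpotent)
  then have "C 0 ** Z = 0"
    using ker by (simp add: twist_kernel_def)
  then have "Z = 0"
    using rank_cond[of 0 Z "- Z"] by (simp add: poly_at_0 matrix_mult_minus_right)
  with \<open>W = 0\<close> show ?thesis by simp
next
  case False
  define \<mu> where "\<mu> = csqrt l"
  have \<mu>: "\<mu> \<noteq> 0" "\<mu>\<^sup>2 = l" using False by (auto simp: \<mu>_def)
  \<comment> \<open>\<open>a\<close> and \<open>b\<close> are the coefficients of the two geometric
    sequences, with the sign of \<open>b\<close> reversed so that the first kernel equation takes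
    the shape of the first premise of \<open>rank_cond\<close>.\<close>
  define a where "a = mat (1 / 2) ** (Z + mat (1 / \<mu>) ** W)"
  define b where "b = mat (1 / 2) ** (mat (1 / \<mu>) ** W - Z)"
  let ?C = "\<lambda>i. conj_mat (C i)"
  have "twist_pow_pair G i Z W = mat (\<mu> ^ i) ** a - mat ((- \<mu>) ^ i) ** b" for i
    using twist_pow_pair_eigen_sqrt[of Z G \<mu> W i] Z W \<mu>
    by (simp add: a_def b_def vec_eq_iff algebra_simps)
  then have "poly_at C k \<mu> ** a - poly_at C k (- \<mu>) ** b = 0"
    using ker by (simp add: twist_kernel_def poly_at_mult matrix_diff_ldistrib sum_subtractf)
  \<comment> \<open>For the pair \<open>W\<close>, \<open>Z ** G\<close> the two coefficients become
    \<open>\<mu>\<close> times \<open>a\<close> and \<open>b\<close>, now with equal signs. The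
    common nonzero factor is cancelled afterwards.\<close>
  moreover have "twist_pow_pair G i W (Z ** G) = mat \<mu> ** (mat (\<mu> ^ i) ** a + mat ((- \<mu>) ^ i) ** b)" for i
  proof -
    have "Z ** G ** G = mat (\<mu>\<^sup>2) ** (Z ** G)"
      using Z \<mu> by (simp add: matrix_mul_assoc[symmetric])
    moreover have "W ** G = mat (\<mu>\<^sup>2) ** W"
      using W \<mu> by simp
    ultimately have *: "twist_pow_pair G i W (Z ** G) =
        mat (\<mu> ^ i) ** (mat (1 / 2) ** (W + mat (1 / \<mu>) ** (mat (\<mu>\<^sup>2) ** Z))) +
        mat ((- \<mu>) ^ i) ** (mat (1 / 2) ** (W - mat (1 / \<mu>) ** (mat (\<mu>\<^sup>2) ** Z)))"
      using twist_pow_pair_eigen_sqrt[of W G \<mu> "Z ** G" i] Z \<mu> by simp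
    show ?thesis
      unfolding * using \<mu>(1) by (simp add: a_def b_def vec_eq_iff field_simps power2_eq_square)
  qed
  then have "mat \<mu> ** (poly_at ?C k \<mu> ** a + poly_at ?C k (- \<mu>) ** b) = 0"
    using ker
    by (simp add: twist_kernel_def poly_at_mult matrix_mult_sum_right matrix_add_ldistrib
        sum.distrib mult_mat_mult[of _ \<mu>])
  then have "poly_at ?C k \<mu> ** a + poly_at ?C k (- \<mu>) ** b = 0"
    using \<mu>(1) by (simp add: vec_eq_iff)
  ultimately have "a = 0" "b = 0"
    using rank_cond by auto
  moreover have "Z = a - b" "W = mat \<mu> ** (a + b)"
    using \<mu>(1) by (simp_all add: a_def b_def vec_eq_iff field_simps)
  ultimately show ?thesis by simp
qed

text \<open>Right multiplication by \<open>G\<close> preserves the kernel, so linear factors of an annihilating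
  polynomial of \<open>G\<close> can be split off one at a time; each step is an eigenvector problem.\<close>

lemma twist_kernel_trivial:
  assumes "twist_kernel C k G Z W"
  shows "Z = 0 \<and> W = 0"
proof -
  have "Z = 0 \<and> W = 0"
    if "q \<noteq> 0" "twist_kernel C k G Z W" "Z ** mat_poly G q = 0" "W ** mat_poly G q = 0" for q Z W
    using that
  proof (induction "degree q" arbitrary: q Z W)
    case 0
    then obtain c where c: "q = [:c:]" "c \<noteq> 0"
      by (metis degree_eq_zeroE pCons_0_0)
    then show ?case
      using 0 by (simp add: vec_eq_iff)
  next
    case (Suc n)
    then obtain l where "poly q l = 0"
      using fundamental_theorem_of_algebra_alt[of q] by fastforce
    then obtain r where r: "q = [:- l, 1:] * r"
      by (auto simp: poly_eq_0_iff_dvd)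
    then have "r \<noteq> 0" "degree r = n"
      using Suc by (auto simp: degree_mult_eq simp del: mult_pCons_left)
    let ?R = "mat_poly G r"
    have q: "mat_poly G q = ?R ** G - mat l ** ?R"
      by (simp only: r mat_poly_linear_mult matrix_diff_rdistrib mat_poly_commute)
    have eigen: "X ** ?R ** G = mat l ** (X ** ?R)"
      if "X ** mat_poly G q = 0" for X :: "complex ^ 'p ^ 'm"
      using that by (simp add: q matrix_diff_ldistrib mult_mat_mult) (simp add: matrix_mul_assoc)
    have "twist_kernel C k G (Z ** ?R) (W ** ?R)"
      using Suc.prems(2) by (rule twist_kernel_mult) (simp add: mat_poly_commute)
    \<comment> \<open>Both products lie in the kernel and satisfy the eigenvalue equation for
      \<open>l\<close>, so they vanish. Thus \<open>r\<close>, of smaller degree, annihilates the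
      same \<open>Z\<close> and \<open>W\<close>.\<close>
    then have "Z ** ?R = 0" "W ** ?R = 0"
      using twist_kernel_eigen eigen Suc.prems(3,4) by blast+
    then show ?case
      using Suc.hyps(1)[of r Z W] \<open>r \<noteq> 0\<close> \<open>degree r = n\<close> Suc.prems(2) by auto
  qed
  moreover obtain q where "q \<noteq> 0" "mat_poly G q = 0"
    by (rule annihilating_poly_exists)
  \<comment> \<open>For an empty sum, \<open>matrix_mult_sum_right\<close> says that a product with
    the zero matrix is zero, so \<open>q\<close> meets the annihilation premises for
    \<open>Z\<close> and \<open>W\<close>.\<close>
  ultimately show ?thesis
    using assms by (metis matrix_mult_sum_right sum.empty)
qed

end

lemma inj_twist_poly:
  fixes C :: "nat \<Rightarrow> complex ^ 'm ^ 'r" and F :: "complex ^ 'p ^ 'p"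
  assumes "\<And>s (a :: complex ^ 'p ^ 'm) b.
      poly_at C k s ** a = poly_at C k (- s) ** b \<Longrightarrow>
      poly_at (\<lambda>i. conj_mat (C i)) k s ** a + poly_at (\<lambda>i. conj_mat (C i)) k (- s) ** b = 0 \<Longrightarrow>
      a = 0 \<and> b = 0"
  shows "inj (twist_poly C k F)"
  unfolding linear_injective_0[OF linear_twist_poly]
proof (intro allI impI)
  fix Z assume Z: "twist_poly C k F Z = 0"
  \<comment> \<open>Applying \<open>twist F\<close> to the equation for \<open>Z\<close> conjugates
    the coefficients and supplies the second equation of \<open>twist_kernel\<close>.\<close>
  have "(\<Sum>i\<le>k. conj_mat (C i) ** (twist F ^^ i) (twist F Z)) = twist F (twist_poly C k F Z)"
    by (simp add: twist_poly_def twist_sum twist_mult funpow_swap1)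
  then have ker: "twist_kernel C k (conj_mat F ** F) Z (twist F Z)"
    using Z by (simp add: twist_kernel_def twist_poly_def twist_power twist_twist)
  have "Z = 0 \<and> twist F Z = 0"
  proof (rule twist_kernel_trivial[of C k])
    show "twist_kernel C k (conj_mat F ** F) Z (twist F Z)"
      by (rule ker)
  qed (rule assms)
  then show "Z = 0" ..
qed

section \<open>Completeness of the parametrized solutions\<close>

lemma sylvester_solutions:
  fixes A :: "complex ^ 'n ^ 'n" and B :: "complex ^ 'm ^ 'n" and F :: "complex ^ 'p ^ 'p"
    and C :: "nat \<Rightarrow> complex ^ 'm ^ ('n + 'm)"
  assumes reach: "antilinear_reachable A B"
    and rec: "hstack A B ** C 0 = 0"
      "\<And>i. i < k \<Longrightarrow> hstack A B ** C (Suc i) = conj_mat (upper_rows (C i))"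
      "upper_rows (C k) = 0"
    and rank_cond: "\<And>s (a :: complex ^ 'p ^ 'm) b.
      poly_at C k s ** a = poly_at C k (- s) ** b \<Longrightarrow>
      poly_at (\<lambda>i. conj_mat (C i)) k s ** a + poly_at (\<lambda>i. conj_mat (C i)) k (- s) ** b = 0 \<Longrightarrow>
      a = 0 \<and> b = 0"
  shows "A ** X + B ** Y = conj_mat X ** F \<longleftrightarrow> (\<exists>Z. vstack X Y = twist_poly C k F Z)"
proof -
  have "sylvester_map A B F (twist_poly C k F Z) = 0" for Z
    by (simp add: sylvester_map_def twist_poly_solves[OF rec])
  \<comment> \<open>With n, m, p the sizes of the index types, the real dimensions are 2p(n+m) for
    the unknowns, 2pm for the parameter and 2pn for the target.\<close>
  then have "sylvester_map A B F (vstack X Y) = 0 \<longleftrightarrow> vstack X Y \<in> range (twist_poly C k F)"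
    by (intro kernel_eq_range_of_dims linear_sylvester_map linear_twist_poly
        surj_sylvester_map[OF reach] inj_twist_poly[OF rank_cond])
      (simp_all add: algebra_simps)
  then show ?thesis
    by (auto simp: sylvester_map_def hstack_mult_vstack twist_def)
qed

section \<open>From the rank and factorization hypotheses to coefficients\<close>

text \<open>Full column rank makes the rows span the whole space, which provides a left
  inverse.\<close>

lemma full_column_rank_imp_ker_trivial:
  fixes M :: "'a::field ^ 'c ^ 'r" and X :: "'a ^ 'd ^ 'c"
  assumes "rank M = CARD('c)" and "M ** X = 0"
  shows "X = 0"
proof -
  have "vec.dim (rows M) = vec.dim (UNIV :: ('a ^ 'c) set)"
    using assms(1) by (simp add: row_rank_def_gen vec_dim_card card_cart_basis)
  then have "vec.span (rows M) = UNIV"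
    using vec.dim_eq_span[of "rows M" UNIV] by simp
  then obtain L where "L ** M = mat 1"
    using matrix_left_invertible_span_rows_gen by blast
  then have "L ** (M ** X) = X"
    by (simp add: matrix_mul_assoc)
  moreover have "L ** (0 :: 'a ^ 'd ^ 'r) = 0"
    by (simp add: vec_eq_iff matrix_matrix_mult_def)
  ultimately show ?thesis
    using assms(2) by simp
qed

lemma eval_pmat_nth [simp]: "eval_pmat P s $ i $ j = poly (P $ i $ j) s"
  by (simp add: eval_pmat_def)

lemma conj_pmat_nth [simp]: "conj_pmat P $ i $ j = map_poly cnj (P $ i $ j)"
  by (simp add: conj_pmat_def)

lemma poly_map_poly_cnj: "poly (map_poly cnj p) s = cnj (poly p (cnj s))"
  by (induction p) (simp_all add: map_poly_pCons)

definition coeff_pmat :: "complex poly ^ 'c ^ 'r \<Rightarrow> nat \<Rightarrow> complex ^ 'c ^ 'r"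
  where "coeff_pmat P k = map_matrix (\<lambda>p. coeff p k) P"

lemma coeff_pmat_nth [simp]: "coeff_pmat P k $ i $ j = coeff (P $ i $ j) k"
  by (simp add: coeff_pmat_def)

lemma coeff_pmat_const_mult: "coeff_pmat (const_pmat A ** P) k = A ** coeff_pmat P k"
  by (simp add: vec_eq_iff matrix_matrix_mult_def coeff_sum const_pmat_def)

lemma coeff_pmat_diff: "coeff_pmat (P - Q) k = coeff_pmat P k - coeff_pmat Q k"
  by (simp add: vec_eq_iff)

lemma coeff_pmat_conj: "coeff_pmat (conj_pmat P) k = conj_mat (coeff_pmat P k)"
  by (simp add: vec_eq_iff coeff_map_poly)

lemma coeff_pmat_shift:
  "coeff_pmat (mat [:0, 1:] ** P) k = (case k of 0 \<Rightarrow> 0 | Suc i \<Rightarrow> coeff_pmat P i)"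
  by (simp add: vec_eq_iff split: nat.split)

text \<open>Comparison of coefficients, where the factor \<open>[:0, 1:]\<close> shifts the index by
  one: index 0 gives the first claim, the indices from 1 to \<open>k\<close> the recursion, and
  \<open>k + 1\<close> the last claim.\<close>

lemma factorization_coeffs:
  fixes A :: "complex ^ 'n ^ 'n" and B :: "complex ^ 'm ^ 'n"
    and P :: "complex poly ^ 'm ^ 'n" and Q :: "complex poly ^ 'm ^ 'm"
    and N :: "nat \<Rightarrow> complex ^ 'm ^ 'n" and D :: "nat \<Rightarrow> complex ^ 'm ^ 'm"
  assumes fact: "mat [:0, 1:] ** conj_pmat P - const_pmat A ** P = const_pmat B ** Q"
    and coeffs: "vstack P Q = (\<Sum>i\<le>k. monom_pmat (vstack (N i) (D i)) i)"
  shows "hstack A B ** vstack (N 0) (D 0) = 0"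
    and "i < k \<Longrightarrow> hstack A B ** vstack (N (Suc i)) (D (Suc i)) = conj_mat (N i)"
    and "N k = 0"
proof -
  have coeff: "coeff_pmat (vstack P Q) j = (if j \<le> k then vstack (N j) (D j) else 0)" for j
    unfolding coeffs by (simp add: vec_eq_iff monom_pmat_def coeff_sum)
  have "coeff_pmat (vstack P Q) j = vstack (coeff_pmat P j) (coeff_pmat Q j)" for j
    by (simp add: vec_eq_iff vstack_def split: sum.split)
  then have PQ: "coeff_pmat P j = (if j \<le> k then N j else 0)"
    "coeff_pmat Q j = (if j \<le> k then D j else 0)" for j
    using coeff[of j] by (auto simp: vstack_eq_iff vstack_eq_0_iff)
  have eq: "coeff_pmat (mat [:0, 1:] ** conj_pmat P) j = A ** coeff_pmat P j + B ** coeff_pmat Q j" for j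
    using arg_cong[OF fact, of "\<lambda>R. coeff_pmat R j"]
    by (simp add: coeff_pmat_diff coeff_pmat_const_mult diff_eq_eq add.commute)
  show "hstack A B ** vstack (N 0) (D 0) = 0"
    using eq[of 0] by (simp add: PQ hstack_mult_vstack coeff_pmat_shift)
  show "hstack A B ** vstack (N (Suc i)) (D (Suc i)) = conj_mat (N i)" if "i < k"
    using eq[of "Suc i"] that
    by (simp add: PQ hstack_mult_vstack coeff_pmat_shift coeff_pmat_conj)
  \<comment> \<open>At index \<open>Suc k\<close> the coefficients of \<open>P\<close> and
    \<open>Q\<close> are zero, so only the shifted term is left.\<close>
  have "conj_mat (N k) = 0"
    using eq[of "Suc k"] by (simp add: PQ coeff_pmat_shift coeff_pmat_conj)
  then show "N k = 0" by simp
qed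

lemma eval_pmat_coeffs:
  fixes P :: "complex poly ^ 'm ^ 'n" and Q :: "complex poly ^ 'm ^ 'l"
    and N :: "nat \<Rightarrow> complex ^ 'm ^ 'n" and D :: "nat \<Rightarrow> complex ^ 'm ^ 'l"
  assumes coeffs: "vstack P Q = (\<Sum>i\<le>k. monom_pmat (vstack (N i) (D i)) i)"
  shows "vstack (eval_pmat P s) (eval_pmat Q s) = poly_at (\<lambda>i. vstack (N i) (D i)) k s"
    and "vstack (eval_pmat (conj_pmat P) s) (eval_pmat (conj_pmat Q) s) =
      poly_at (\<lambda>i. conj_mat (vstack (N i) (D i))) k s"
proof -
  have *: "poly (vstack P Q $ i $ j) s = poly_at (\<lambda>i. vstack (N i) (D i)) k s $ i $ j" for i j s
    unfolding coeffs by (simp add: poly_at_def monom_pmat_def poly_sum poly_monom mult.commute)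
  have "vstack (eval_pmat P s) (eval_pmat Q s) = eval_pmat (vstack P Q) s"
    by (simp add: vec_eq_iff vstack_def split: sum.split)
  also have "\<dots> = poly_at (\<lambda>i. vstack (N i) (D i)) k s"
    by (simp add: vec_eq_iff *)
  finally show "vstack (eval_pmat P s) (eval_pmat Q s) = poly_at (\<lambda>i. vstack (N i) (D i)) k s" .
  \<comment> \<open>Evaluating at \<open>cnj s\<close> and conjugating the result restores the
    powers of \<open>s\<close> and conjugates just the coefficients.\<close>
  have "vstack (eval_pmat (conj_pmat P) s) (eval_pmat (conj_pmat Q) s) =
      conj_mat (eval_pmat (vstack P Q) (cnj s))"
    by (simp add: vec_eq_iff vstack_def poly_map_poly_cnj split: sum.split)
  also have "\<dots> = poly_at (\<lambda>i. conj_mat (vstack (N i) (D i))) k s"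
    by (simp add: vec_eq_iff *) (simp add: poly_at_def)
  finally show "vstack (eval_pmat (conj_pmat P) s) (eval_pmat (conj_pmat Q) s) =
      poly_at (\<lambda>i. conj_mat (vstack (N i) (D i))) k s" .
qed

text \<open>The two premises on \<open>a\<close> and \<open>b\<close> say that the block matrix maps
  \<open>vstack a b\<close> to zero: the upper two block rows give the difference, the lower two the
  sum.\<close>

lemma full_rank_imp_rank_cond:
  fixes P :: "complex poly ^ 'm ^ 'n" and Q :: "complex poly ^ 'm ^ 'm"
    and N :: "nat \<Rightarrow> complex ^ 'm ^ 'n" and D :: "nat \<Rightarrow> complex ^ 'm ^ 'm"
  assumes full_rank: "rank
        (vstack (hstack (eval_pmat P s) (- eval_pmat P (- s)))
        (vstack (hstack (eval_pmat Q s) (- eval_pmat Q (- s)))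
        (vstack (hstack (eval_pmat (conj_pmat P) s) (eval_pmat (conj_pmat P) (- s)))
                (hstack (eval_pmat (conj_pmat Q) s) (eval_pmat (conj_pmat Q) (- s))))))
        = 2 * CARD('m)"
    and coeffs: "vstack P Q = (\<Sum>i\<le>k. monom_pmat (vstack (N i) (D i)) i)"
    and C: "C = (\<lambda>i. vstack (N i) (D i))"
    and ab: "poly_at C k s ** a = poly_at C k (- s) ** b"
      "poly_at (\<lambda>i. conj_mat (C i)) k s ** a + poly_at (\<lambda>i. conj_mat (C i)) k (- s) ** b = 0"
  shows "a = 0 \<and> b = 0"
proof -
  have add: "vstack U V + vstack U' V' = vstack (U + U') (V + V')"
    for U U' :: "complex ^ 'p ^ 'n" and V V' :: "complex ^ 'p ^ 'm"
    by (simp add: vec_eq_iff vstack_def split: sum.split)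
  have "vstack (eval_pmat P s ** a) (eval_pmat Q s ** a) =
      vstack (eval_pmat P (- s) ** b) (eval_pmat Q (- s) ** b)"
    using ab(1) by (simp add: C eval_pmat_coeffs(1)[OF coeffs, symmetric] vstack_mult)
  moreover have "vstack (eval_pmat (conj_pmat P) s ** a + eval_pmat (conj_pmat P) (- s) ** b)
      (eval_pmat (conj_pmat Q) s ** a + eval_pmat (conj_pmat Q) (- s) ** b) = 0"
    using ab(2) by (simp add: C eval_pmat_coeffs(2)[OF coeffs, symmetric] vstack_mult add)
  ultimately have "vstack (hstack (eval_pmat P s) (- eval_pmat P (- s)))
        (vstack (hstack (eval_pmat Q s) (- eval_pmat Q (- s)))
        (vstack (hstack (eval_pmat (conj_pmat P) s) (eval_pmat (conj_pmat P) (- s)))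
                (hstack (eval_pmat (conj_pmat Q) s) (eval_pmat (conj_pmat Q) (- s))))) **
      vstack a b = 0"
    by (simp add: vstack_mult hstack_mult_vstack vstack_eq_iff vstack_eq_0_iff
        matrix_mult_minus_left)
  then have "vstack a b = 0"
    by (rule full_column_rank_imp_ker_trivial[rotated]) (simp add: full_rank)
  then show ?thesis
    by (simp add: vstack_eq_0_iff)
qed

theorem corollary3:
  fixes td :: time_domain
    and A\<^sub>2 :: "complex ^ 'n ^ 'n"
    and B\<^sub>2 :: "complex ^ 'm ^ 'n"
    and F\<^sub>2 :: "complex ^ 'p ^ 'p"
    and N\<^sub>0 :: "complex poly ^ 'm ^ 'n"
    and D\<^sub>0 :: "complex poly ^ 'm ^ 'm"
    and N :: "nat \<Rightarrow> complex ^ 'm ^ 'n"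
    and D :: "nat \<Rightarrow> complex ^ 'm ^ 'm"
    and \<omega> :: nat
  assumes controllable: "antilinear_controllable td A\<^sub>2 B\<^sub>2"
    and factorization:
      "mat [:0, 1:] ** conj_pmat N\<^sub>0 - const_pmat A\<^sub>2 ** N\<^sub>0 = const_pmat B\<^sub>2 ** D\<^sub>0"
    and full_rank:
      "\<And>s. rank
        (vstack (hstack (eval_pmat N\<^sub>0 s) (- eval_pmat N\<^sub>0 (- s)))
        (vstack (hstack (eval_pmat D\<^sub>0 s) (- eval_pmat D\<^sub>0 (- s)))
        (vstack (hstack (eval_pmat (conj_pmat N\<^sub>0) s) (eval_pmat (conj_pmat N\<^sub>0) (- s)))
                (hstack (eval_pmat (conj_pmat D\<^sub>0) s) (eval_pmat (conj_pmat D\<^sub>0) (- s))))))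
        = 2 * CARD('m)"
    and coefficients:
      "vstack N\<^sub>0 D\<^sub>0 = (\<Sum>i\<le>\<omega>. monom_pmat (vstack (N i) (D i)) i)"
  shows
    "(\<forall>(X\<^sub>1 :: complex ^ 'p ^ 'n) (Y\<^sub>1 :: complex ^ 'p ^ 'm).
        conj_mat A\<^sub>2 ** conj_mat X\<^sub>1 + conj_mat B\<^sub>2 ** conj_mat Y\<^sub>1 = X\<^sub>1 ** conj_mat F\<^sub>2 \<longleftrightarrow>
        (\<exists>Z\<^sub>1 :: complex ^ 'p ^ 'm.
          vstack X\<^sub>1 Y\<^sub>1 =
            (\<Sum>i | i \<le> \<omega> \<and> even i.
              vstack (N i) (D i) ** Z\<^sub>1 ** matpow (conj_mat F\<^sub>2 ** F\<^sub>2) (i div 2)) +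
            (\<Sum>i | i \<le> \<omega> \<and> odd i.
              vstack (N i) (D i) ** conj_mat Z\<^sub>1 ** F\<^sub>2 **
                matpow (conj_mat F\<^sub>2 ** F\<^sub>2) ((i - 1) div 2)))) \<and>
     (\<forall>(X\<^sub>2 :: complex ^ 'p ^ 'n) (Y\<^sub>2 :: complex ^ 'p ^ 'm).
        conj_mat A\<^sub>2 ** X\<^sub>2 + conj_mat B\<^sub>2 ** Y\<^sub>2 = conj_mat X\<^sub>2 ** F\<^sub>2 \<longleftrightarrow>
        (\<exists>Z\<^sub>2 :: complex ^ 'p ^ 'm.
          vstack X\<^sub>2 Y\<^sub>2 =
            (\<Sum>i | i \<le> \<omega> \<and> even i.
              vstack (conj_mat (N i)) (conj_mat (D i)) ** Z\<^sub>2 **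
                matpow (conj_mat F\<^sub>2 ** F\<^sub>2) (i div 2)) +
            (\<Sum>i | i \<le> \<omega> \<and> odd i.
              vstack (conj_mat (N i)) (conj_mat (D i)) ** conj_mat Z\<^sub>2 ** F\<^sub>2 **
                matpow (conj_mat F\<^sub>2 ** F\<^sub>2) ((i - 1) div 2))))"
proof -
  define C where "C = (\<lambda>i. vstack (N i) (D i))"
  let ?C = "\<lambda>i. conj_mat (C i)"
  have reach: "antilinear_reachable (conj_mat A\<^sub>2) (conj_mat B\<^sub>2)"
    using controllable by (rule controllable_imp_reachable)
  have rec: "hstack A\<^sub>2 B\<^sub>2 ** C (Suc i) = conj_mat (upper_rows (C i))" if "i < \<omega>" for i
    using factorization_coeffs[OF factorization coefficients] that by (auto simp: C_def)
  have rec0: "hstack A\<^sub>2 B\<^sub>2 ** C 0 = 0" "upper_rows (C \<omega>) = 0"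
    using factorization_coeffs[OF factorization coefficients] by (auto simp: C_def)
  note cond = full_rank_imp_rank_cond[OF full_rank coefficients C_def]
  have "A\<^sub>2 ** X + B\<^sub>2 ** Y = conj_mat X ** F\<^sub>2 \<longleftrightarrow> (\<exists>Z. vstack X Y = twist_poly C \<omega> F\<^sub>2 Z)"
    for X :: "complex ^ 'p ^ 'n" and Y :: "complex ^ 'p ^ 'm"
    by (rule sylvester_solutions[OF reachable_conj[OF reach] rec0(1) rec rec0(2) cond])
  moreover have "conj_mat A\<^sub>2 ** conj_mat X + conj_mat B\<^sub>2 ** conj_mat Y = X ** conj_mat F\<^sub>2 \<longleftrightarrow>
      A\<^sub>2 ** X + B\<^sub>2 ** Y = conj_mat X ** F\<^sub>2"
    for X :: "complex ^ 'p ^ 'n" and Y :: "complex ^ 'p ^ 'm"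
  proof -
    have "conj_mat U = conj_mat V \<longleftrightarrow> U = V" for U V :: "complex ^ 'p ^ 'n"
      by (metis conj_mat_conj_mat)
    from this[of "A\<^sub>2 ** X + B\<^sub>2 ** Y" "conj_mat X ** F\<^sub>2"] show ?thesis
      by (simp add: conj_mat_add conj_mat_mult)
  qed
  ultimately have first: "conj_mat A\<^sub>2 ** conj_mat X + conj_mat B\<^sub>2 ** conj_mat Y = X ** conj_mat F\<^sub>2 \<longleftrightarrow>
      (\<exists>Z. vstack X Y = twist_poly C \<omega> F\<^sub>2 Z)"
    for X :: "complex ^ 'p ^ 'n" and Y :: "complex ^ 'p ^ 'm"
    by simp
  have stack: "hstack (conj_mat A\<^sub>2) (conj_mat B\<^sub>2) ** conj_mat W = conj_mat (hstack A\<^sub>2 B\<^sub>2 ** W)"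
    for W :: "complex ^ 'm ^ ('n + 'm)"
    by (subst (2) vstack_rows[symmetric], subst vstack_rows[of W, symmetric])
      (simp only: conj_mat_vstack hstack_mult_vstack conj_mat_add conj_mat_mult)
  have upper: "upper_rows (conj_mat W) = conj_mat (upper_rows W)" for W :: "complex ^ 'm ^ ('n + 'm)"
    by (simp add: upper_rows_def vec_eq_iff)
  have second: "conj_mat A\<^sub>2 ** X + conj_mat B\<^sub>2 ** Y = conj_mat X ** F\<^sub>2 \<longleftrightarrow>
      (\<exists>Z. vstack X Y = twist_poly ?C \<omega> F\<^sub>2 Z)"
    for X :: "complex ^ 'p ^ 'n" and Y :: "complex ^ 'p ^ 'm"
  proof (rule sylvester_solutions[OF reach])
    fix s and a b :: "complex ^ 'p ^ 'm"
    assume ab: "poly_at ?C \<omega> s ** a = poly_at ?C \<omega> (- s) ** b"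
      "poly_at (\<lambda>i. conj_mat (?C i)) \<omega> s ** a + poly_at (\<lambda>i. conj_mat (?C i)) \<omega> (- s) ** b = 0"
    \<comment> \<open>Conjugating the coefficients exchanges the two premises of the rank condition,
      up to the sign of \<open>b\<close>.\<close>
    have "a = 0 \<and> - b = 0"
      using ab by (intro cond[of s]) (simp_all add: matrix_mult_minus_right eq_neg_iff_add_eq_0)
    then show "a = 0 \<and> b = 0" by simp
  qed (simp_all add: stack upper rec rec0)
  show ?thesis
    using first second by (simp add: twist_poly_even_odd C_def conj_mat_vstack)
qed

end
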